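(* Let $\tau_0=a_0+b_0i\in\mathcal{F}$ be a quadratic irrationality. Define $\tau_k=a_k+b_ki$ for $k\ge1$ recursively by $a_k=\frac12$, $b_k=\frac{a_{k-1}^2+b_{k-1}^2-a_{k-1}}{2b_{k-1}}$, and let $n$ be the least positive integer with $|\tau_n|\le 1$ (so that $\tau_1,\dots,\tau_n$ is the deep hole sequence of $\tau_0$, with $\Lambda_{\tau_k}=H(\Lambda_{\tau_{k-1}})$). For each $0\le k\le n$ let $E_{\tau_k}=\mathbb{C}/\Lambda_{\tau_k}$ be the corresponding CM elliptic curve. Then all the elliptic curves $E_{\tau_0},\dots,E_{\tau_n}$ are isogenous. Furthermore, for any $0\le k\le n-1$ there exists an isogeny between $E_{\tau_k}$ and $E_{\tau_{k+1}}$ of degree $$\delta_k\le\frac{12\sqrt3\, b_{k+1}\, d_k^4\,(a_k^2+b_k^2)^2}{b_k},$$ where $d_k=\min\{d\in\mathbb{Z}_{>0}: da_k\in\mathbb{Z},\ d^2b_k^2\in\mathbb{Z}\}$.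
   Context: $\mathcal{F}=\{\tau=a+bi\in\mathbb{C}: b\ge0,\ 0\le a\le 1/2,\ |\tau|\ge 1\}$. For $\tau=a+bi$, $\Lambda_\tau=\operatorname{span}_{\mathbb{Z}}\{1,\tau\}\subset\mathbb{C}$, identified with $\begin{pmatrix}1&a\\0&b\end{pmatrix}\mathbb{Z}^2\subset\mathbb{R}^2$. For a lattice $L\subset\mathbb{R}^2$ with minimal basis vectors $\boldsymbol{x}_1,\boldsymbol{x}_2$ ($\|\boldsymbol{x}_1\|\le\|\boldsymbol{x}_2\|$ the successive minima, angle between them in $[\pi/3,\pi/2]$), the fundamental deep hole $\boldsymbol{z}$ is the unique point of maximal distance from $L$ lying in the triangle with vertices $\boldsymbol{0},\boldsymbol{x}_1,\boldsymbol{x}_2$, and $H(L)=\operatorname{span}_{\mathbb{Z}}\{\boldsymbol{x}_1,\boldsymbol{z}\}$. An isogeny $\mathbb{C}/\Lambda\to\mathbb{C}/\Lambda'$ is a map $z\mapsto\beta z$ with $\beta\in\mathbb{C}^*$, $\beta\Lambda\subseteq\Lambda'$; its degree is $[\Lambda':\beta\Lambda]$. *)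

theory Defs
  imports "HOL-Analysis.Analysis"
begin

text \<open>The plane is \<^typ>\<open>complex\<close>, with its real inner product structure.\<close>

definition fund_domain :: "complex set" where
  "fund_domain = {\<tau>. 0 \<le> Im \<tau> \<and> 0 \<le> Re \<tau> \<and> Re \<tau> \<le> 1/2 \<and> 1 \<le> cmod \<tau>}"

definition zspan :: "complex \<Rightarrow> complex \<Rightarrow> complex set" where
  "zspan x y = {of_int m * x + of_int n * y | m n :: int. True}"

definition Lat :: "complex \<Rightarrow> complex set" where
  "Lat \<tau> = zspan 1 \<tau>"

definition quadratic_irrationality :: "complex \<Rightarrow> bool" where
  "quadratic_irrationality \<tau> \<longleftrightarrow> \<tau> \<notin> \<rat> \<and>
     (\<exists>A B C :: int. A \<noteq> 0 \<and> of_int A * \<tau>\<^sup>2 + of_int B * \<tau> + of_int C = 0)"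

definition successive_minimum :: "nat \<Rightarrow> complex set \<Rightarrow> real" where
  "successive_minimum i L = Inf {r. 0 \<le> r \<and> i \<le> dim (span (L \<inter> cball 0 r))}"

definition angle_between :: "complex \<Rightarrow> complex \<Rightarrow> real" where
  "angle_between x y = arccos ((x \<bullet> y) / (norm x * norm y))"

definition minimal_basis :: "complex set \<Rightarrow> complex \<Rightarrow> complex \<Rightarrow> bool" where
  "minimal_basis L x1 x2 \<longleftrightarrow> L = zspan x1 x2 \<and> norm x1 \<le> norm x2 \<and>
     norm x1 = successive_minimum 1 L \<and> norm x2 = successive_minimum 2 L \<and>
     angle_between x1 x2 \<in> {pi/3..pi/2}"

definition deep_hole :: "complex set \<Rightarrow> complex \<Rightarrow> bool" where
  "deep_hole L z \<longleftrightarrow> (\<forall>w. infdist w L \<le> infdist z L)"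

definition fundamental_deep_hole ::
    "complex set \<Rightarrow> complex \<Rightarrow> complex \<Rightarrow> complex \<Rightarrow> bool" where
  "fundamental_deep_hole L x1 x2 z \<longleftrightarrow>
     {w \<in> convex hull {0, x1, x2}. deep_hole L w} = {z}"

text \<open>
  The relation \<open>M = H(L)\<close>. It is a relation rather than a function because \<open>x1\<close> is not determined
  (not even up to sign) when the two successive minima of \<open>L\<close> coincide.
\<close>
definition deep_hole_lattice :: "complex set \<Rightarrow> complex set \<Rightarrow> bool" where
  "deep_hole_lattice L M \<longleftrightarrow>
     (\<exists>x1 x2 z. minimal_basis L x1 x2 \<and> fundamental_deep_hole L x1 x2 z \<and> M = zspan x1 z)"

primrec tau_seq :: "complex \<Rightarrow> nat \<Rightarrow> complex" where
  "tau_seq \<tau>0 0 = \<tau>0"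
| "tau_seq \<tau>0 (Suc k) =
     (let a = Re (tau_seq \<tau>0 k); b = Im (tau_seq \<tau>0 k)
      in Complex (1/2) ((a\<^sup>2 + b\<^sup>2 - a) / (2 * b)))"

text \<open>
  The elliptic curve \<open>\<complex>/\<Lambda>\<close> is represented by its period lattice \<open>\<Lambda>\<close>, and the isogeny
  \<open>z \<mapsto> \<beta> z\<close> from \<open>\<complex>/\<Lambda>\<close> to \<open>\<complex>/\<Lambda>'\<close> by its multiplier \<open>\<beta>\<close>.
\<close>
definition isogeny :: "complex \<Rightarrow> complex set \<Rightarrow> complex set \<Rightarrow> bool" where
  "isogeny \<beta> \<Lambda> \<Lambda>' \<longleftrightarrow> \<beta> \<noteq> 0 \<and> (*) \<beta> ` \<Lambda> \<subseteq> \<Lambda>'"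

definition isogenous :: "complex set \<Rightarrow> complex set \<Rightarrow> bool" where
  "isogenous \<Lambda> \<Lambda>' \<longleftrightarrow> (\<exists>\<beta>. isogeny \<beta> \<Lambda> \<Lambda>')"

text \<open>The index \<open>[\<Lambda> : M]\<close> of additive groups; an infinite index yields the junk value \<open>0\<close>.\<close>
definition lattice_index :: "complex set \<Rightarrow> complex set \<Rightarrow> nat" where
  "lattice_index \<Lambda> M = card (\<Lambda> // {(x, y). x \<in> \<Lambda> \<and> y \<in> \<Lambda> \<and> x - y \<in> M})"

definition isogeny_degree :: "complex \<Rightarrow> complex set \<Rightarrow> complex set \<Rightarrow> nat" where
  "isogeny_degree \<beta> \<Lambda> \<Lambda>' = lattice_index \<Lambda>' ((*) \<beta> ` \<Lambda>)"

definition denom :: "complex \<Rightarrow> nat" where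
  "denom \<tau> = (LEAST d. 0 < d \<and> of_nat d * Re \<tau> \<in> \<int> \<and> (of_nat d)\<^sup>2 * (Im \<tau>)\<^sup>2 \<in> \<int>)"

end

theory Submission
  imports Defs
begin

text \<open>
  The fundamental deep hole of a reduced lattice \<open>\<Lambda>\<^sub>\<tau>\<close> is the circumcentre \<open>\<sigma>\<close> of the non-obtuse triangle
  \<open>0, 1, \<tau>\<close>, and \<open>\<sigma>\<close> is the next term of the sequence. Imaginary parts at least halve at each step, so
  the sequence reaches the unit disc. If \<open>d\<close> clears the denominators of \<open>\<tau>\<close> and
  \<open>D = d\<^sup>2 (|\<tau>|\<^sup>2 - Re \<tau>)\<close>, then \<open>\<beta> = 2 D \<sigma> / \<tau>\<close> satisfies \<open>\<beta> \<tau> = 2 D \<sigma>\<close> and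
  \<open>\<beta> = d\<^sup>2 |\<tau> - 1|\<^sup>2 - 2 d\<^sup>2 (1 - Re \<tau>) \<sigma>\<close>, hence is an isogeny of degree \<open>2 D d\<^sup>2 |\<tau> - 1|\<^sup>2\<close>. The bound
  on the degree then follows from \<open>|\<tau> - 1|\<^sup>2 \<le> 2 |\<tau>|\<^sup>2\<close>.
\<close>

text \<open>Real part 1/2 is the perpendicular bisector of 0 and 1. With
  \<open>a = Re \<tau>\<close> and \<open>b = Im \<tau>\<close>, the imaginary part \<open>y\<close>
  solves \<open>2 * b * y = a^2 + b^2 - a\<close>, which expresses equal distance from 0 and
  \<tau>.\<close>

definition circumcentre :: "complex \<Rightarrow> complex" where
  "circumcentre \<tau> = Complex (1/2) (((Re \<tau>)\<^sup>2 + (Im \<tau>)\<^sup>2 - Re \<tau>) / (2 * Im \<tau>))"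

lemma tau_seq_Suc: "tau_seq \<tau> (Suc k) = circumcentre (tau_seq \<tau> k)"
  by (simp add: circumcentre_def Let_def)

declare tau_seq.simps(2) [simp del]

text \<open>\<open>fund_domain\<close> only asks for \<open>0 \<le> Im \<tau>\<close>; strictness
  follows because a real number in [0, 1/2] has modulus below 1.\<close>

lemma fund_domainD:
  assumes "\<tau> \<in> fund_domain"
  shows "0 \<le> Re \<tau>" "Re \<tau> \<le> 1/2" "0 < Im \<tau>" "1 \<le> (Re \<tau>)\<^sup>2 + (Im \<tau>)\<^sup>2"
proof -
  show "0 \<le> Re \<tau>" "Re \<tau> \<le> 1/2"
    using assms by (auto simp: fund_domain_def)
  show N: "1 \<le> (Re \<tau>)\<^sup>2 + (Im \<tau>)\<^sup>2"
    using assms by (auto simp: fund_domain_def cmod_def)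
  have "(Re \<tau>)\<^sup>2 \<le> (1/2)\<^sup>2"
    by (rule power_mono) fact+
  then have "Im \<tau> \<noteq> 0"
    using N by (auto simp: power2_eq_square)
  then show "0 < Im \<tau>"
    using assms by (auto simp: fund_domain_def)
qed

section \<open>The deep hole of a reduced lattice\<close>

lemma cmod_lattice_point_sq:
  "(cmod (of_int m + of_int n * \<tau>))\<^sup>2 =
    (of_int m)\<^sup>2 + 2 * of_int m * of_int n * Re \<tau> + (of_int n)\<^sup>2 * (cmod \<tau>)\<^sup>2"
  unfolding cmod_power2 by simp algebra

lemma Lat_iff: "w \<in> Lat \<tau> \<longleftrightarrow> (\<exists>m n :: int. w = of_int m + of_int n * \<tau>)"
  by (auto simp: Lat_def zspan_def)

lemma Lat_mem [simp]: "0 \<in> Lat \<tau>" "1 \<in> Lat \<tau>" "\<tau> \<in> Lat \<tau>"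
proof -
  have "0 = of_int 0 + of_int 0 * \<tau>" "1 = of_int 1 + of_int 0 * \<tau>" "\<tau> = of_int 0 + of_int 1 * \<tau>"
    by simp_all
  then show "0 \<in> Lat \<tau>" "1 \<in> Lat \<tau>" "\<tau> \<in> Lat \<tau>"
    unfolding Lat_iff by blast+
qed

lemma Lat_diff: "x \<in> Lat \<tau> \<Longrightarrow> y \<in> Lat \<tau> \<Longrightarrow> x - y \<in> Lat \<tau>"
  unfolding Lat_iff
  by (elim exE, rule_tac x = "m - ma" in exI, rule_tac x = "n - na" in exI)
    (simp add: algebra_simps)

lemma mult_ge_min:
  fixes x t :: real
  assumes "0 \<le> t" "t \<le> 1"
  shows "min 0 x \<le> t * x"
  using assms mult_left_le_one_le[of "- x" t] by (cases "0 \<le> x") auto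

text \<open>The worst case of \<open>real_form_ge_0\<close>: \<open>N = 1\<close>, and by
  \<open>mult_ge_min\<close> the cross term with coefficient \<open>2 * a\<close> in [0, 1] is at
  least \<open>min 0 (m * n)\<close>. Products of consecutive integers are nonnegative, so only
  opposite signs of \<open>m\<close> and \<open>n\<close> need work.\<close>

lemma int_form_ge_0:
  fixes m n :: int
  shows "0 \<le> m * (m - 1) + n * (n - 1) + min 0 (m * n)"
proof -
  have c: "0 \<le> k * (k - 1)" for k :: int
    by (cases "k \<le> 0") (auto simp: mult_nonpos_nonpos)
  have *: "0 \<le> m * (m - 1) + n * (n - 1) + m * n" if "m > 0" "n < 0" for m n :: int
  proof -
    have "m * (m - 1) + n * (n - 1) + m * n = (m + n)\<^sup>2 + m * (- n - 1) - n"
      by (simp add: power2_eq_square algebra_simps)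
    moreover have "0 \<le> m * (- n - 1)"
      using that by (intro mult_nonneg_nonneg) auto
    ultimately show ?thesis
      using that zero_le_power2[of "m + n"] by linarith
  qed
  show ?thesis
  proof (cases "0 \<le> m * n")
    case True
    then show ?thesis using c[of m] c[of n] by simp
  next
    case False
    then consider "m > 0" "n < 0" | "m < 0" "n > 0"
      by (auto simp: not_le mult_less_0_iff)
    then show ?thesis
      using *[of m n] *[of n m] False by cases (auto simp: algebra_simps)
  qed
qed

text \<open>In \<open>circumcentre_far\<close> this form is the excess of the squared distance from
  the circumcentre to \<open>m + n * \<tau>\<close> over that to 0. The coefficient of
  \<open>N\<close> is a product of consecutive integers, so \<open>N\<close> can be lowered to
  1.\<close>

lemma real_form_ge_0:
  fixes m n :: int and a N :: real
  assumes "0 \<le> a" "a \<le> 1/2" "1 \<le> N"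
  shows "0 \<le> m * (m - 1) + N * (n * (n - 1)) + 2 * a * (m * n)"
proof -
  have "0 \<le> n * (n - 1)"
    by (cases "n \<le> 0") (auto simp: mult_nonpos_nonpos)
  then have "0 \<le> real_of_int (n * (n - 1))"
    by linarith
  then have "1 * (real_of_int (n * (n - 1))) \<le> N * (n * (n - 1))"
    using assms by (intro mult_right_mono) auto
  moreover have "min 0 (real_of_int (m * n)) \<le> 2 * a * (m * n)"
    using mult_ge_min[of "2 * a" "real_of_int (m * n)"] assms by simp
  moreover have "0 \<le> real_of_int (m * (m - 1) + n * (n - 1) + min 0 (m * n))"
    using int_form_ge_0[of m n] by linarith
  ultimately show ?thesis
    by (simp add: of_int_min)
qed

text \<open>The difference of the squared moduli is
  \<open>m^2 + N * (n^2 - 1) + 2 * Re \<tau> * (m * n)\<close>. Lowering \<open>N\<close> to 1 and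
  the cross term to \<open>min 0 (m * n)\<close> leaves an integer expression; for
  \<open>m * n < 0\<close> it is \<open>(m + n)^2 - m * n - 1\<close>.\<close>

lemma cmod_lattice_point_ge:
  assumes "\<tau> \<in> fund_domain" "n \<noteq> 0"
  shows "cmod \<tau> \<le> cmod (of_int m + of_int n * \<tau>)"
proof -
  define N where "N = (cmod \<tau>)\<^sup>2"
  note \<tau> = fund_domainD[OF assms(1)]
  have N: "1 \<le> N"
    using \<tau>(4) by (simp add: N_def cmod_power2)
  have "0 < n\<^sup>2"
    using \<open>n \<noteq> 0\<close> by simp
  then have n2: "0 \<le> n\<^sup>2 - 1"
    by linarith
  then have "0 \<le> real_of_int (n\<^sup>2 - 1)"
    by linarith
  then have "1 * real_of_int (n\<^sup>2 - 1) \<le> N * real_of_int (n\<^sup>2 - 1)"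
    using N by (intro mult_right_mono) auto
  moreover have "min 0 (real_of_int (m * n)) \<le> 2 * Re \<tau> * (m * n)"
    using mult_ge_min[of "2 * Re \<tau>" "real_of_int (m * n)"] \<tau> by simp
  moreover have "0 \<le> m\<^sup>2 + (n\<^sup>2 - 1) + min 0 (m * n)"
  proof (cases "m * n < 0")
    case True
    have "m\<^sup>2 + n\<^sup>2 + m * n = (m + n)\<^sup>2 - m * n"
      by (simp add: power2_eq_square algebra_simps)
    also have "\<dots> \<ge> 1"
      using True zero_le_power2[of "m + n"] by linarith
    finally show ?thesis using True by simp
  qed (use n2 in simp)
  then have "0 \<le> real_of_int (m\<^sup>2 + (n\<^sup>2 - 1) + min 0 (m * n))"
    by linarith
  ultimately have "N \<le> (cmod (of_int m + of_int n * \<tau>))\<^sup>2"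
    unfolding cmod_lattice_point_sq N_def[symmetric] by (simp add: of_int_min algebra_simps)
  then show ?thesis
    unfolding N_def by (rule power2_le_imp_le) simp
qed

lemma cmod_lattice_point_ge_1:
  assumes "\<tau> \<in> fund_domain" "w \<in> Lat \<tau>" "w \<noteq> 0"
  shows "1 \<le> cmod w"
proof -
  obtain m n :: int where w: "w = of_int m + of_int n * \<tau>"
    using assms(2) by (auto simp: Lat_iff)
  show ?thesis
  proof (cases "n = 0")
    case True
    then show ?thesis using w assms(3) by auto
  next
    case False
    then show ?thesis
      using cmod_lattice_point_ge[OF assms(1), of n m] assms(1) w by (auto simp: fund_domain_def)
  qed
qed

section \<open>The minimal basis 1, \<tau>\<close>

lemma independent_1_tau:
  assumes "Im \<tau> \<noteq> 0"
  shows "independent {1, \<tau>}" "\<tau> \<noteq> 1"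
proof -
  have "\<tau> \<notin> span {1}"
    using assms by (auto simp: span_singleton complex_eq_iff)
  then show "independent {1, \<tau>}"
    by (subst insert_commute) (simp add: independent_insert)
  show "\<tau> \<noteq> 1"
    using assms by auto
qed

lemma successive_minimum_eqI:
  assumes "0 \<le> r" "i \<le> dim (span (L \<inter> cball 0 r))"
    and "\<And>s. s < r \<Longrightarrow> dim (span (L \<inter> cball 0 s)) < i"
  shows "successive_minimum i L = r"
  unfolding successive_minimum_def
proof (rule cInf_eq_minimum)
  fix s assume "s \<in> {r. 0 \<le> r \<and> i \<le> dim (span (L \<inter> cball 0 r))}"
  then show "r \<le> s"
    using assms(3)[of s] by (cases "s < r") auto
qed (use assms in auto)

lemma minimal_basis_Lat:
  assumes "\<tau> \<in> fund_domain"
  shows "minimal_basis (Lat \<tau>) 1 \<tau>"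
proof -
  note \<tau> = fund_domainD[OF assms]
  have norm: "1 \<le> norm \<tau>"
    using assms by (simp add: fund_domain_def)
  have 1: "successive_minimum 1 (Lat \<tau>) = 1"
  proof (rule successive_minimum_eqI)
    have "dim {1 :: complex} \<le> dim (Lat \<tau> \<inter> cball 0 1)"
      by (rule dim_subset) auto
    then show "1 \<le> dim (span (Lat \<tau> \<inter> cball 0 1))"
      by simp
    fix s :: real assume "s < 1"
    then have "Lat \<tau> \<inter> cball 0 s \<subseteq> {0}"
      using cmod_lattice_point_ge_1[OF assms] by force
    then have "dim (Lat \<tau> \<inter> cball 0 s) \<le> dim {0 :: complex}"
      by (rule dim_subset)
    then show "dim (span (Lat \<tau> \<inter> cball 0 s)) < 1"
      by simp
  qed simp
  have 2: "successive_minimum 2 (Lat \<tau>) = norm \<tau>"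
  proof (rule successive_minimum_eqI)
    have "dim {1, \<tau>} \<le> dim (Lat \<tau> \<inter> cball 0 (norm \<tau>))"
      using norm by (intro dim_subset) auto
    then show "2 \<le> dim (span (Lat \<tau> \<inter> cball 0 (norm \<tau>)))"
      using dim_eq_card_independent[OF independent_1_tau(1), of \<tau>] independent_1_tau(2)[of \<tau>] \<tau>(3)
      by simp
    fix s :: real assume "s < norm \<tau>"
    \<comment> \<open>A lattice vector shorter than \<tau> has no \<tau>-component, so these vectors
      span at most a line.\<close>
    have "Lat \<tau> \<inter> cball 0 s \<subseteq> span {1}"
    proof
      fix w assume "w \<in> Lat \<tau> \<inter> cball 0 s"
      then obtain m n :: int where w: "w = of_int m + of_int n * \<tau>" "cmod w \<le> s"
        by (auto simp: Lat_iff)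
      then have "n = 0"
        using cmod_lattice_point_ge[OF assms, of n m] \<open>s < norm \<tau>\<close> by force
      then show "w \<in> span {1}"
        using w by (auto simp: span_singleton intro!: image_eqI[of _ _ "of_int m"] simp: scaleR_conv_of_real)
    qed
    then have "dim (Lat \<tau> \<inter> cball 0 s) \<le> dim (span {1 :: complex})"
      by (rule dim_subset)
    also have "\<dots> \<le> 1"
      by simp
    finally show "dim (span (Lat \<tau> \<inter> cball 0 s)) < 2"
      by simp
  qed simp
  \<comment> \<open>This quotient is the cosine of the angle between 1 and \<tau>; its bounds 0 and
    1/2 correspond to pi/2 and pi/3.\<close>
  have "Re \<tau> / norm \<tau> \<le> 1/2"
    using \<tau> norm by (simp add: divide_simps)
  moreover have "0 \<le> Re \<tau> / norm \<tau>"
    using \<tau> norm by simp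
  ultimately have "arccos (1/2) \<le> arccos (Re \<tau> / norm \<tau>)" "arccos (Re \<tau> / norm \<tau>) \<le> arccos 0"
    by (intro arccos_le_arccos; linarith)+
  moreover have "arccos (1/2) = pi / 3"
    using arccos_cos[of "pi / 3"] cos_60 by simp
  moreover have "angle_between 1 \<tau> = arccos (Re \<tau> / norm \<tau>)"
    by (simp add: angle_between_def inner_complex_def)
  ultimately have "angle_between 1 \<tau> \<in> {pi/3..pi/2}"
    by simp
  then show ?thesis
    using 1 2 norm by (simp add: minimal_basis_def Lat_def)
qed

text \<open>For a convex combination \<open>w\<close> of points \<open>v\<^sub>i\<close> on a circle with centre \<open>z\<close> and radius \<open>R\<close>, the
  weighted mean of \<open>|w - v\<^sub>i|\<^sup>2\<close> is \<open>R\<^sup>2 - |w - z|\<^sup>2\<close>, so some \<open>v\<^sub>i\<close> is at least that close.\<close>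
lemma near_vertex:
  fixes w z u v :: complex
  assumes w: "w = of_real s * u + of_real t * v" and st: "0 \<le> s" "0 \<le> t" "s + t \<le> 1"
    and R: "cmod (u - z) = cmod z" "cmod (v - z) = cmod z"
  shows "\<exists>x\<in>{0, u, v}. (dist w x)\<^sup>2 \<le> (cmod z)\<^sup>2 - (dist w z)\<^sup>2"
proof (rule ccontr)
  define r where "r = (cmod z)\<^sup>2 - (dist w z)\<^sup>2"
  assume "\<not> ?thesis"
  then have *: "r < (dist w 0)\<^sup>2" "r < (dist w u)\<^sup>2" "r < (dist w v)\<^sup>2"
    by (auto simp: r_def)
  have R': "(cmod (u - z))\<^sup>2 = (cmod z)\<^sup>2" "(cmod (v - z))\<^sup>2 = (cmod z)\<^sup>2"
    using R by simp_all
  have "(1 - s - t) * (dist w 0)\<^sup>2 + s * (dist w u)\<^sup>2 + t * (dist w v)\<^sup>2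
      = (1 - s - t) * (cmod z)\<^sup>2 + s * (cmod (u - z))\<^sup>2 + t * (cmod (v - z))\<^sup>2 - (dist w z)\<^sup>2"
    unfolding dist_norm w cmod_power2 by (simp add: power2_eq_square) algebra
  also have "\<dots> = r"
    unfolding R' r_def by algebra
  \<comment> \<open>Three nonnegative terms with sum zero all vanish. The differences are strictly
    positive, so every weight is 0, although the weights add up to 1.\<close>
  finally have "(1 - s - t) * ((dist w 0)\<^sup>2 - r) + s * ((dist w u)\<^sup>2 - r) + t * ((dist w v)\<^sup>2 - r) = 0"
    by (simp add: algebra_simps)
  moreover have "0 \<le> (1 - s - t) * ((dist w 0)\<^sup>2 - r)" "0 \<le> s * ((dist w u)\<^sup>2 - r)"
    "0 \<le> t * ((dist w v)\<^sup>2 - r)"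
    using st * by (intro mult_nonneg_nonneg; simp)+
  ultimately have "(1 - s - t) * ((dist w 0)\<^sup>2 - r) = 0" "s * ((dist w u)\<^sup>2 - r) = 0"
    "t * ((dist w v)\<^sup>2 - r) = 0"
    by linarith+
  then show False
    using * by auto
qed

section \<open>The circumcentre as deep hole, and the covering radius\<close>

lemma circumcentre_equidistant:
  assumes "Im \<tau> \<noteq> 0"
  shows "cmod (1 - circumcentre \<tau>) = cmod (circumcentre \<tau>)"
    and "cmod (\<tau> - circumcentre \<tau>) = cmod (circumcentre \<tau>)"
proof -
  show "cmod (1 - circumcentre \<tau>) = cmod (circumcentre \<tau>)"
    by (simp add: circumcentre_def cmod_def)
  have "(Re \<tau> - 1/2)\<^sup>2 + (Im \<tau> - y)\<^sup>2 = (1/2)\<^sup>2 + y\<^sup>2"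
    if "2 * Im \<tau> * y = (Re \<tau>)\<^sup>2 + (Im \<tau>)\<^sup>2 - Re \<tau>" for y
    using that by algebra
  then show "cmod (\<tau> - circumcentre \<tau>) = cmod (circumcentre \<tau>)"
    using assms by (simp add: circumcentre_def cmod_def)
qed

lemma hull_0_1_tau:
  "convex hull {0, 1, \<tau>} = {of_real s + of_real t * \<tau> | s t. 0 \<le> s \<and> 0 \<le> t \<and> s + t \<le> 1}"
  by (subst convex_hull_3_alt) (auto simp: scaleR_conv_of_real algebra_simps)

lemma circumcentre_in_hull:
  assumes "\<tau> \<in> fund_domain"
  shows "circumcentre \<tau> \<in> convex hull {0, 1, \<tau>}"
proof -
  note \<tau> = fund_domainD[OF assms]
  define a b N where "a = Re \<tau>" "b = Im \<tau>" "N = a\<^sup>2 + b\<^sup>2"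
  note ab = \<tau>[folded a_b_N_def]
  \<comment> \<open>The barycentric weights of 1 and \<tau>, obtained by solving
    \<open>s + t * a = 1/2\<close> and \<open>t * b = (N - a) / (2 * b)\<close>. The weight of 0
    contains the factor \<open>N + 1 - 2 * a\<close>, the squared modulus of
    \<open>\<tau> - 1\<close>.\<close>
  define s t where "s = N * (1 - a) / (2 * b\<^sup>2)" "t = (N - a) / (2 * b\<^sup>2)"
  have 0: "0 \<le> s" "0 \<le> t"
    using ab by (auto simp: s_t_def a_b_N_def intro!: divide_nonneg_nonneg mult_nonneg_nonneg)
  have "1 - s - t = a * (N + 1 - 2 * a) / (2 * b\<^sup>2)"
    using ab unfolding s_t_def a_b_N_def(3) by (simp add: field_simps) algebra
  also have "\<dots> \<ge> 0"
    using ab unfolding a_b_N_def(3) by (intro divide_nonneg_nonneg mult_nonneg_nonneg) auto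
  finally have 1: "s + t \<le> 1"
    by simp
  have "s + t * a = 1/2" "t * b = (N - a) / (2 * b)"
    using ab unfolding s_t_def a_b_N_def(3) by (simp_all add: field_simps power2_eq_square)
  then have "circumcentre \<tau> = of_real s + of_real t * \<tau>"
    by (simp add: circumcentre_def complex_eq_iff flip: a_b_N_def)
  then show ?thesis
    using 0 1 unfolding hull_0_1_tau by blast
qed

lemma circumcentre_far:
  assumes "\<tau> \<in> fund_domain" "x \<in> Lat \<tau>"
  shows "cmod (circumcentre \<tau>) \<le> dist (circumcentre \<tau>) x"
proof -
  note \<tau> = fund_domainD[OF assms(1)]
  obtain m n :: int where x: "x = of_int m + of_int n * \<tau>"
    using assms(2) by (auto simp: Lat_iff)
  define a b N y where "a = Re \<tau>" "b = Im \<tau>" "N = a\<^sup>2 + b\<^sup>2" "y = Im (circumcentre \<tau>)"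
  note ab = \<tau>[folded a_b_N_y_def]
  have y: "2 * b * y = N - a"
    using ab by (simp add: a_b_N_y_def circumcentre_def)
  have "(dist (circumcentre \<tau>) x)\<^sup>2 - (cmod (circumcentre \<tau>))\<^sup>2
      = (1/2 - (m + n * a))\<^sup>2 + (y - n * b)\<^sup>2 - ((1/2)\<^sup>2 + y\<^sup>2)"
    by (simp add: x dist_norm cmod_power2 a_b_N_y_def) (simp add: circumcentre_def)
  \<comment> \<open>The \<open>y^2\<close> terms cancel and \<open>y\<close> survives only in
    \<open>2 * n * b * y\<close>, which the circumcentre equation replaces by
    \<open>n * (N - a)\<close>.\<close>
  also have "\<dots> = m * (m - 1) + N * (n * (n - 1)) + 2 * a * (m * n)"
    using y unfolding a_b_N_y_def(3) by simp algebra
  also have "\<dots> \<ge> 0"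
    using real_form_ge_0[of a N m n] ab unfolding a_b_N_y_def(3) by blast
  finally show ?thesis
    by (intro power2_le_imp_le[OF _ zero_le_dist]) simp
qed

lemma infdist_circumcentre:
  assumes "\<tau> \<in> fund_domain"
  shows "infdist (circumcentre \<tau>) (Lat \<tau>) = cmod (circumcentre \<tau>)"
proof (rule antisym)
  show "infdist (circumcentre \<tau>) (Lat \<tau>) \<le> cmod (circumcentre \<tau>)"
    using infdist_le[of 0 "Lat \<tau>" "circumcentre \<tau>"] by simp
  show "cmod (circumcentre \<tau>) \<le> infdist (circumcentre \<tau>) (Lat \<tau>)"
    unfolding infdist_def using circumcentre_far[OF assms] Lat_mem(1)[of \<tau>]
    by (auto intro!: cINF_greatest simp del: Lat_mem)
qed

text \<open>The subtracted term gives uniqueness of the deep hole: a point of the triangle whose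
  distance to the lattice reaches the circumradius must be the circumcentre itself.\<close>

lemma infdist_hull_le:
  assumes "Im \<tau> \<noteq> 0" "w \<in> convex hull {0, 1, \<tau>}"
  shows "(infdist w (Lat \<tau>))\<^sup>2 \<le> (cmod (circumcentre \<tau>))\<^sup>2 - (dist w (circumcentre \<tau>))\<^sup>2"
proof -
  obtain s t where "w = of_real s * 1 + of_real t * \<tau>" "0 \<le> s" "0 \<le> t" "s + t \<le> 1"
    using assms(2) by (auto simp: hull_0_1_tau)
  from near_vertex[OF this circumcentre_equidistant[OF assms(1)]]
  obtain x where "x \<in> {0, 1, \<tau>}" and
    x: "(dist w x)\<^sup>2 \<le> (cmod (circumcentre \<tau>))\<^sup>2 - (dist w (circumcentre \<tau>))\<^sup>2"
    by blast
  then have "x \<in> Lat \<tau>"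
    by auto
  have "(infdist w (Lat \<tau>))\<^sup>2 \<le> (dist w x)\<^sup>2"
    by (intro power_mono infdist_le infdist_nonneg) fact
  with x show ?thesis by linarith
qed

text \<open>Translation by the lattice and the reflection \<open>w \<mapsto> 1 + \<tau> - w\<close> move any point into the
  fundamental triangle.\<close>
lemma infdist_le_circumradius:
  assumes "Im \<tau> \<noteq> 0"
  shows "infdist w (Lat \<tau>) \<le> cmod (circumcentre \<tau>)"
proof -
  define t where "t = Im w / Im \<tau>"
  define s where "s = Re w - t * Re \<tau>"
  have w: "w = of_real s + of_real t * \<tau>"
    using assms by (simp add: s_def t_def complex_eq_iff)
  define l where "l = of_int \<lfloor>s\<rfloor> + of_int \<lfloor>t\<rfloor> * \<tau>"
  have l: "l \<in> Lat \<tau>" "l + 1 + \<tau> \<in> Lat \<tau>"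
  proof -
    have "l + 1 + \<tau> = of_int (\<lfloor>s\<rfloor> + 1) + of_int (\<lfloor>t\<rfloor> + 1) * \<tau>"
      by (simp add: l_def algebra_simps)
    then show "l + 1 + \<tau> \<in> Lat \<tau>" "l \<in> Lat \<tau>"
      unfolding Lat_iff l_def by blast+
  qed
  have wl: "w - l = of_real (frac s) + of_real (frac t) * \<tau>"
    by (simp add: w l_def frac_def algebra_simps)
  \<comment> \<open>It suffices to find a point \<open>v\<close> of the triangle each of whose
    distances to lattice points is also a distance from \<open>w\<close> to a lattice point.\<close>
  have bound: "infdist w (Lat \<tau>) \<le> cmod (circumcentre \<tau>)"
    if v: "v \<in> convex hull {0, 1, \<tau>}"
      and inv: "\<And>x. x \<in> Lat \<tau> \<Longrightarrow> \<exists>y\<in>Lat \<tau>. dist w y = dist v x" for v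
  proof -
    have "infdist w (Lat \<tau>) \<le> infdist v (Lat \<tau>)"
    proof (subst (2) infdist_notempty)
      show ne: "Lat \<tau> \<noteq> {}"
        using Lat_mem(1) by blast
      show "infdist w (Lat \<tau>) \<le> (INF x\<in>Lat \<tau>. dist v x)"
      proof (rule cINF_greatest[OF ne])
        fix x assume "x \<in> Lat \<tau>"
        then show "infdist w (Lat \<tau>) \<le> dist v x"
          using inv infdist_le by metis
      qed
    qed
    also have "\<dots> \<le> cmod (circumcentre \<tau>)"
    proof (rule power2_le_imp_le)
      show "(infdist v (Lat \<tau>))\<^sup>2 \<le> (cmod (circumcentre \<tau>))\<^sup>2"
        using infdist_hull_le[OF assms v] zero_le_power2[of "dist v (circumcentre \<tau>)"] by linarith
    qed simp
    finally show ?thesis .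
  qed
  show ?thesis
  \<comment> \<open>The diagonal from \<open>l + 1\<close> to \<open>l + \<tau>\<close> cuts the
    cell of \<open>w\<close> into a translate of the triangle and a point reflection of it.\<close>
  proof (cases "frac s + frac t \<le> 1")
    case True
    show ?thesis
    proof (rule bound)
      show "w - l \<in> convex hull {0, 1, \<tau>}"
        unfolding wl hull_0_1_tau using True by (blast intro: frac_ge_0)
      show "\<exists>y\<in>Lat \<tau>. dist w y = dist (w - l) x" if "x \<in> Lat \<tau>" for x
        using Lat_diff[OF that Lat_diff[OF Lat_mem(1) l(1)]]
        by (intro bexI[of _ "x - (0 - l)"]) (auto simp: dist_norm algebra_simps)
    qed
  next
    case False
    show ?thesis
    proof (rule bound)
      have "l + 1 + \<tau> - w = of_real (1 - frac s) + of_real (1 - frac t) * \<tau>"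
        using wl by (simp add: algebra_simps)
      moreover have "0 \<le> 1 - frac s" "0 \<le> 1 - frac t" "(1 - frac s) + (1 - frac t) \<le> 1"
        using False frac_lt_1[of s] frac_lt_1[of t] by linarith+
      ultimately show "l + 1 + \<tau> - w \<in> convex hull {0, 1, \<tau>}"
        unfolding hull_0_1_tau by blast
      show "\<exists>y\<in>Lat \<tau>. dist w y = dist (l + 1 + \<tau> - w) x" if "x \<in> Lat \<tau>" for x
        using Lat_diff[OF l(2) that]
        by (intro bexI[of _ "l + 1 + \<tau> - x"])
          (auto simp: dist_norm norm_minus_commute algebra_simps)
    qed
  qed
qed

lemma fundamental_deep_hole_Lat:
  assumes "\<tau> \<in> fund_domain"
  shows "fundamental_deep_hole (Lat \<tau>) 1 \<tau> (circumcentre \<tau>)"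
proof -
  have Im: "Im \<tau> \<noteq> 0"
    using fund_domainD(3)[OF assms] by simp
  have "w = circumcentre \<tau>" if "w \<in> convex hull {0, 1, \<tau>}" "deep_hole (Lat \<tau>) w" for w
  proof -
    have "cmod (circumcentre \<tau>) \<le> infdist w (Lat \<tau>)"
      using that(2) infdist_circumcentre[OF assms] by (metis deep_hole_def)
    then have "(cmod (circumcentre \<tau>))\<^sup>2 \<le> (infdist w (Lat \<tau>))\<^sup>2"
      by (rule power_mono) simp
    then have "(dist w (circumcentre \<tau>))\<^sup>2 \<le> 0"
      using infdist_hull_le[OF Im that(1)] by linarith
    then show ?thesis by simp
  qed
  moreover have "deep_hole (Lat \<tau>) (circumcentre \<tau>)"
    unfolding deep_hole_def infdist_circumcentre[OF assms]
    using infdist_le_circumradius[OF Im] by blast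
  ultimately show ?thesis
    using circumcentre_in_hull[OF assms] unfolding fundamental_deep_hole_def by blast
qed

lemma deep_hole_lattice_circumcentre:
  assumes "\<tau> \<in> fund_domain"
  shows "deep_hole_lattice (Lat \<tau>) (Lat (circumcentre \<tau>))"
  using minimal_basis_Lat[OF assms] fundamental_deep_hole_Lat[OF assms]
  unfolding deep_hole_lattice_def Lat_def[of "circumcentre \<tau>"] by blast

section \<open>Isogenies\<close>

lemma isogenous_refl: "isogenous L L"
  by (auto simp: isogenous_def isogeny_def intro!: exI[of _ 1])

lemma isogenous_trans:
  assumes "isogenous L M" "isogenous M K"
  shows "isogenous L K"
proof -
  obtain \<beta> \<gamma> where "isogeny \<beta> L M" "isogeny \<gamma> M K"
    using assms by (auto simp: isogenous_def)
  then have "isogeny (\<gamma> * \<beta>) L K"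
    by (auto simp: isogeny_def mult.assoc image_subset_iff)
  then show ?thesis
    by (auto simp: isogenous_def)
qed

lemma isogeny_LatI:
  assumes "\<beta> \<noteq> 0" "\<beta> \<in> Lat \<sigma>" "\<beta> * \<tau> \<in> Lat \<sigma>"
  shows "isogeny \<beta> (Lat \<tau>) (Lat \<sigma>)"
proof -
  obtain p q r s :: int where 1: "\<beta> = of_int p + of_int q * \<sigma>"
    and 2: "\<beta> * \<tau> = of_int r + of_int s * \<sigma>"
    using assms by (auto simp: Lat_iff)
  have "\<beta> * (of_int m + of_int n * \<tau>) \<in> Lat \<sigma>" for m n :: int
  proof -
    have "\<beta> * (of_int m + of_int n * \<tau>) = of_int m * \<beta> + of_int n * (\<beta> * \<tau>)"
      by (simp add: algebra_simps)
    also have "\<dots> = of_int (m * p + n * r) + of_int (m * q + n * s) * \<sigma>"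
      unfolding 2 by (subst 1) (simp add: algebra_simps)
    finally show ?thesis
      unfolding Lat_iff by blast
  qed
  then show ?thesis
    using assms(1) by (auto simp: isogeny_def Lat_iff[of _ \<tau>])
qed

lemma Lat_coords_unique:
  fixes m n p q :: int
  assumes "Im \<sigma> \<noteq> 0" "of_int m + of_int n * \<sigma> = of_int p + of_int q * \<sigma>"
  shows "m = p \<and> n = q"
proof -
  have "of_int n * Im \<sigma> = of_int q * Im \<sigma>"
    using arg_cong[OF assms(2), of Im] by simp
  then have "n = q"
    using assms(1) by simp
  then show ?thesis
    using assms(2) by simp
qed

text \<open>Since \<open>\<beta>\<Lambda>\<close> has a triangular basis, the residues \<open>i + j\<sigma>\<close> with \<open>0 \<le> i < A\<close> and \<open>0 \<le> j < E\<close>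
  represent the cosets.\<close>
lemma isogeny_degree_triangular:
  fixes A B E :: int
  assumes \<sigma>: "Im \<sigma> \<noteq> 0" and pos: "0 < A" "0 < E"
    and \<beta>: "\<beta> = of_int A - of_int B * \<sigma>" "\<beta> * \<tau> = of_int E * \<sigma>"
  shows "isogeny_degree \<beta> (Lat \<tau>) (Lat \<sigma>) = nat (A * E)"
proof -
  define M where "M = (*) \<beta> ` Lat \<tau>"
  define R where "R = {(x, y). x \<in> Lat \<sigma> \<and> y \<in> Lat \<sigma> \<and> x - y \<in> M}"
  have M_iff: "of_int p + of_int q * \<sigma> \<in> M \<longleftrightarrow> (\<exists>m n. p = m * A \<and> q = n * E - m * B)"
    (is "?l \<longleftrightarrow> ?r") for p q :: int
  proof -
    have *: "\<beta> * (of_int m + of_int n * \<tau>) = of_int (m * A) + of_int (n * E - m * B) * \<sigma>" for m n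
    proof -
      have "\<beta> * (of_int m + of_int n * \<tau>) = of_int m * \<beta> + of_int n * (\<beta> * \<tau>)"
        by (simp add: algebra_simps)
      then show ?thesis
        unfolding \<beta>(2) by (subst (asm) \<beta>(1)) (simp add: algebra_simps)
    qed
    have "?l \<longleftrightarrow> (\<exists>m n :: int. of_int p + of_int q * \<sigma> = \<beta> * (of_int m + of_int n * \<tau>))"
      unfolding M_def image_iff Bex_def Lat_iff by blast
    also have "\<dots> \<longleftrightarrow> ?r"
      unfolding * using Lat_coords_unique[OF \<sigma>] by metis
    finally show ?thesis .
  qed
  have M0: "0 \<in> M"
    by (auto simp: M_def image_iff intro!: bexI[of _ 0])
  have M_diff: "x - y \<in> M" if "x \<in> M" "y \<in> M" for x y
    using that Lat_diff unfolding M_def by (auto simp flip: right_diff_distrib)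
  have equiv: "equiv (Lat \<sigma>) R"
  proof (rule equivI)
    show "R \<subseteq> Lat \<sigma> \<times> Lat \<sigma>" "refl_on (Lat \<sigma>) R"
      by (auto simp: R_def refl_on_def M0)
    show "sym R"
      by (rule symI) (use M_diff[OF M0] in \<open>force simp: R_def\<close>)
    show "trans R"
    proof (rule transI)
      fix x y z assume "(x, y) \<in> R" "(y, z) \<in> R"
      then show "(x, z) \<in> R"
        using M_diff[of "x - y" "0 - (y - z)"] M_diff[OF M0, of "y - z"] by (auto simp: R_def)
    qed
  qed
  define rep where "rep = (\<lambda>(i :: int, j :: int). of_int i + of_int j * \<sigma>)"
  have rep: "rep ij \<in> Lat \<sigma>" for ij
    by (auto simp: rep_def Lat_iff split: prod.splits)
  have R_rep: "(rep (p, q), rep (i, j)) \<in> R \<longleftrightarrow>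
      (\<exists>m n. p - i = m * A \<and> q - j = n * E - m * B)" for p q i j
  proof -
    have "rep (p, q) - rep (i, j) = of_int (p - i) + of_int (q - j) * \<sigma>"
      by (simp add: rep_def algebra_simps)
    then show ?thesis
      using M_iff[of "p - i" "q - j"] rep by (simp add: R_def)
  qed
  have "bij_betw (\<lambda>ij. R `` {rep ij}) ({0..<A} \<times> {0..<E}) (Lat \<sigma> // R)"
    unfolding bij_betw_def
  proof (intro conjI inj_onI set_eqI iffI)
    fix x y assume xy: "x \<in> {0..<A} \<times> {0..<E}" "y \<in> {0..<A} \<times> {0..<E}"
      and eq: "R `` {rep x} = R `` {rep y}"
    obtain p q i j where [simp]: "x = (p, q)" "y = (i, j)"
      by (cases x, cases y)
    have "(rep x, rep y) \<in> R"
      using eq_equiv_class[OF eq equiv] rep by blast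
    then obtain m n where mn: "p - i = m * A" "q - j = n * E - m * B"
      using R_rep by auto
    \<comment> \<open>Two residues in the same range differ by less than the modulus. Applied to the
      first coordinate this gives \<open>m = 0\<close>, which removes the offset
      \<open>m * B\<close> before it is applied to the second.\<close>
    have small: "k = 0" if "u - v = k * C" "0 \<le> u" "u < C" "0 \<le> v" "v < C" for u v k C :: int
    proof -
      have "\<bar>k * C\<bar> < C"
        using that by linarith
      then show ?thesis
        using that by (simp add: abs_mult)
    qed
    have "m = 0"
      using small[OF mn(1)] xy by simp
    moreover from this have "n = 0"
      using small[of q j n E] mn xy by simp
    ultimately show "x = y"
      using mn by simp
  next
    fix C assume "C \<in> (\<lambda>ij. R `` {rep ij}) ` ({0..<A} \<times> {0..<E})"
    then show "C \<in> Lat \<sigma> // R"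
      using rep by (auto intro: quotientI)
  next
    fix C assume "C \<in> Lat \<sigma> // R"
    then obtain x where x: "x \<in> Lat \<sigma>" "C = R `` {x}"
      by (rule quotientE)
    then obtain p q where x_eq: "x = rep (p, q)"
      by (auto simp: Lat_iff rep_def)
    \<comment> \<open>Subtracting \<open>m * \<beta>\<close> reduces the first coordinate to
      \<open>p mod A\<close> but shifts the second by \<open>m * B\<close>; hence \<open>s\<close>,
      not \<open>q\<close>, is reduced modulo \<open>E\<close>.\<close>
    define m where "m = p div A"
    define s where "s = q + m * B"
    have "p - p mod A = m * A"
      by (simp add: m_def minus_mod_eq_div_mult)
    moreover have "q - s mod E = (s div E) * E - m * B"
      using minus_mod_eq_div_mult[of s E] by (simp add: s_def)
    ultimately have "(x, rep (p mod A, s mod E)) \<in> R"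
      unfolding x_eq R_rep by blast
    then have "C = R `` {rep (p mod A, s mod E)}"
      unfolding x(2) by (rule equiv_class_eq[OF equiv])
    then show "C \<in> (\<lambda>ij. R `` {rep ij}) ` ({0..<A} \<times> {0..<E})"
      using pos by (intro image_eqI[of _ _ "(p mod A, s mod E)"]) auto
  qed
  then have "card (Lat \<sigma> // R) = card ({0..<A} \<times> {0..<E})"
    by (simp add: bij_betw_same_card)
  also have "\<dots> = nat (A * E)"
    using pos by (simp add: card_cartesian_product nat_mult_distrib)
  finally show ?thesis
    by (simp add: isogeny_degree_def lattice_index_def R_def M_def)
qed

text \<open>The dual isogeny: \<open>A * E / \<beta>\<close> maps back, because it equals
  \<open>E + B * \<tau>\<close> and sends \<sigma> to \<open>A * \<tau>\<close>.\<close>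

lemma isogenous_sym_triangular:
  fixes A B E :: int
  assumes "\<beta> \<noteq> 0" "A \<noteq> 0" "E \<noteq> 0"
    and \<beta>: "\<beta> = of_int A - of_int B * \<sigma>" "\<beta> * \<tau> = of_int E * \<sigma>"
  shows "isogenous (Lat \<sigma>) (Lat \<tau>)"
proof -
  define \<gamma> where "\<gamma> = of_int (A * E) / \<beta>"
  have "of_int (A * E) = (of_int E + of_int B * \<tau>) * \<beta>"
    using \<beta> unfolding of_int_mult by algebra
  then have 1: "\<gamma> = of_int E + of_int B * \<tau>"
    using assms(1) by (simp add: \<gamma>_def divide_eq_eq)
  have "of_int (A * E) * \<sigma> = of_int A * \<tau> * \<beta>"
    using \<beta>(2) by (simp add: algebra_simps)
  then have 2: "\<gamma> * \<sigma> = of_int 0 + of_int A * \<tau>"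
    using assms(1) by (simp add: \<gamma>_def divide_eq_eq)
  have "\<gamma> \<noteq> 0"
    using assms by (simp add: \<gamma>_def)
  then have "isogeny \<gamma> (Lat \<sigma>) (Lat \<tau>)"
    using 1 2 by (intro isogeny_LatI) (auto simp: Lat_iff simp del: of_int_0)
  then show ?thesis
    by (auto simp: isogenous_def)
qed

section \<open>Denominators\<close>

text \<open>The form in which the arithmetic hypothesis travels along the sequence: it ensures that
  \<open>denom\<close> exists, and it passes to the circumcentre because the square of the new
  imaginary part involves \<open>Im \<tau>\<close> only through its square.\<close>

definition rational_coords :: "complex \<Rightarrow> bool" where
  "rational_coords \<tau> \<longleftrightarrow> Re \<tau> \<in> \<rat> \<and> (Im \<tau>)\<^sup>2 \<in> \<rat>"

text \<open>The imaginary part of the quadratic equation, divided by \<open>Im \<tau>\<close>, makes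
  \<open>Re \<tau>\<close> rational; the real part then determines the square of
  \<open>Im \<tau>\<close>.\<close>

lemma rational_coords_quadratic:
  assumes "quadratic_irrationality \<tau>" "Im \<tau> \<noteq> 0"
  shows "rational_coords \<tau>"
proof -
  obtain A B C :: int where A: "A \<noteq> 0" and eq: "of_int A * \<tau>\<^sup>2 + of_int B * \<tau> + of_int C = 0"
    using assms(1) by (auto simp: quadratic_irrationality_def)
  have re: "of_int A * ((Re \<tau>)\<^sup>2 - (Im \<tau>)\<^sup>2) + of_int B * Re \<tau> + of_int C = 0"
    using arg_cong[OF eq, of Re] by (simp add: power2_eq_square)
  have "Im \<tau> * (2 * of_int A * Re \<tau> + of_int B) = 0"
    using arg_cong[OF eq, of Im] by (simp add: power2_eq_square algebra_simps)
  then have "2 * of_int A * Re \<tau> + of_int B = 0"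
    using assms(2) by simp
  then have "Re \<tau> = - of_int B / (2 * of_int A)"
    using A by (simp add: field_simps)
  then have Re: "Re \<tau> \<in> \<rat>"
    by simp
  have "(Im \<tau>)\<^sup>2 = (Re \<tau>)\<^sup>2 + (of_int B * Re \<tau> + of_int C) / of_int A"
    using re A by (simp add: field_simps)
  then have "(Im \<tau>)\<^sup>2 \<in> \<rat>"
    using Re by simp
  with Re show ?thesis
    by (simp add: rational_coords_def)
qed

lemma rational_coords_circumcentre:
  assumes "rational_coords \<tau>"
  shows "rational_coords (circumcentre \<tau>)"
  using assms by (simp add: rational_coords_def circumcentre_def power_divide power_mult_distrib)

lemma denom_props:
  assumes "rational_coords \<tau>"
  shows "0 < denom \<tau>" "of_nat (denom \<tau>) * Re \<tau> \<in> \<int>" "(of_nat (denom \<tau>))\<^sup>2 * (Im \<tau>)\<^sup>2 \<in> \<int>"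
proof -
  have clear: "\<exists>n::nat. 0 < n \<and> of_nat n * x \<in> \<int>" if x: "x \<in> \<rat>" for x :: real
  proof -
    obtain p :: int and n :: nat where "n \<noteq> 0" "x = of_int p / of_nat n"
      using x by (auto simp: Rats_eq_int_div_nat)
    then show ?thesis
      by (intro exI[of _ n]) simp
  qed
  \<comment> \<open>The product \<open>u * v\<close> clears both coordinates at once, so the set
    whose least element is \<open>denom \<tau>\<close> is nonempty.\<close>
  obtain u v :: nat where u: "0 < u" "of_nat u * Re \<tau> \<in> \<int>" and v: "0 < v" "of_nat v * (Im \<tau>)\<^sup>2 \<in> \<int>"
    using clear assms unfolding rational_coords_def by meson
  have "of_nat (u * v) * Re \<tau> = of_nat v * (of_nat u * Re \<tau>)"
    "(of_nat (u * v))\<^sup>2 * (Im \<tau>)\<^sup>2 = of_nat (u\<^sup>2 * v) * (of_nat v * (Im \<tau>)\<^sup>2)"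
    by (simp_all add: power2_eq_square)
  then have "0 < u * v \<and> of_nat (u * v) * Re \<tau> \<in> \<int> \<and> (of_nat (u * v))\<^sup>2 * (Im \<tau>)\<^sup>2 \<in> \<int>"
    using u v by (simp only: Ints_mult Ints_of_nat) simp
  then have "0 < denom \<tau> \<and> of_nat (denom \<tau>) * Re \<tau> \<in> \<int> \<and> (of_nat (denom \<tau>))\<^sup>2 * (Im \<tau>)\<^sup>2 \<in> \<int>"
    unfolding denom_def by (rule LeastI)
  then show "0 < denom \<tau>" "of_nat (denom \<tau>) * Re \<tau> \<in> \<int>" "(of_nat (denom \<tau>))\<^sup>2 * (Im \<tau>)\<^sup>2 \<in> \<int>"
    by blast+
qed

section \<open>The explicit multiplier and the degree bound\<close>

lemma Im_circumcentre_pos: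
  assumes "\<tau> \<in> fund_domain"
  shows "0 < Im (circumcentre \<tau>)"
  using fund_domainD[OF assms] by (simp add: circumcentre_def)

text \<open>The multiplier is chosen so that \<open>\<beta> * \<tau>\<close> is an integer multiple
  of the circumcentre. The image lattice then has the triangular basis required by
  \<open>isogeny_degree_triangular\<close>, with index \<open>A * E\<close>.\<close>

lemma circumcentre_multiplier:
  fixes \<tau> :: complex
  defines "a \<equiv> Re \<tau>" and "b \<equiv> Im \<tau>" and "d \<equiv> real (denom \<tau>)"
  assumes fd: "\<tau> \<in> fund_domain" and rat: "rational_coords \<tau>"
  obtains \<beta> and A B E :: int where
    "of_int A = d\<^sup>2 * (a\<^sup>2 + b\<^sup>2 - 2 * a + 1)" "of_int E = 2 * d\<^sup>2 * (a\<^sup>2 + b\<^sup>2 - a)"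
    "0 < A" "0 < E" "\<beta> \<noteq> 0"
    "\<beta> = of_int A - of_int B * circumcentre \<tau>" "\<beta> * \<tau> = of_int E * circumcentre \<tau>"
proof -
  note ab = fund_domainD[OF fd, folded a_def b_def]
  note den = denom_props[OF rat, folded a_def b_def d_def]
  obtain p q :: int where p: "d * a = of_int p" and q: "d\<^sup>2 * b\<^sup>2 = of_int q"
    using den by (auto elim!: Ints_cases)
  define e where "e = int (denom \<tau>)"
  have d: "d = of_int e" "0 < d"
    using den by (simp_all add: e_def d_def)
  \<comment> \<open>The coefficients are polynomials in the integers \<open>p = d * a\<close>,
    \<open>q = d^2 * b^2\<close> and \<open>e = d\<close>, which makes their integrality
    evident.\<close>
  define A where "A = p\<^sup>2 + q - 2 * e * p + e\<^sup>2"
  define B where "B = 2 * (e\<^sup>2 - e * p)"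
  define E where "E = 2 * (p\<^sup>2 + q - e * p)"
  have A: "of_int A = d\<^sup>2 * (a\<^sup>2 + b\<^sup>2 - 2 * a + 1)"
    unfolding A_def by (simp flip: p q d) algebra
  have B: "of_int B = 2 * d\<^sup>2 * (1 - a)"
    unfolding B_def by (simp flip: p q d) algebra
  have E: "of_int E = 2 * d\<^sup>2 * (a\<^sup>2 + b\<^sup>2 - a)"
    unfolding E_def by (simp flip: p q d) algebra
  have "0 < real_of_int A" "0 < real_of_int E"
    unfolding A E using ab d by (auto intro!: mult_pos_pos)
  then have pos: "0 < A" "0 < E"
    by simp_all
  define \<sigma> where "\<sigma> = circumcentre \<tau>"
  define y where "y = Im \<sigma>"
  define \<beta> where "\<beta> = of_int A - of_int B * \<sigma>"
  have \<sigma>: "Re \<sigma> = 1/2" "Im \<sigma> = y" and y: "2 * b * y = a\<^sup>2 + b\<^sup>2 - a"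
    using ab by (simp_all add: \<sigma>_def y_def circumcentre_def a_def b_def)
  have \<beta>_Re: "Re \<beta> = of_int A - of_int B / 2" and \<beta>_Im: "Im \<beta> = - (of_int B * y)"
    by (simp_all add: \<beta>_def \<sigma>)
  have "\<beta> * \<tau> = of_int E * \<sigma>"
  proof (rule complex_eqI)
    have "(of_int A - of_int B / 2) * a + of_int B * y * b = of_int E / 2"
      unfolding A B E using y by simp algebra
    then show "Re (\<beta> * \<tau>) = Re (of_int E * \<sigma>)"
      by (simp add: \<sigma> \<beta>_Re \<beta>_Im flip: a_def b_def)
    \<comment> \<open>After multiplication by \<open>b\<close>, the unknown \<open>y\<close> occurs
      only in the product \<open>b * y\<close>, which the circumcentre equation eliminates.\<close>
    have "b * ((of_int A - of_int B / 2) * b - of_int B * y * a) = b * (of_int E * y)"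
      unfolding A B E using y by simp algebra
    then have "(of_int A - of_int B / 2) * b - of_int B * y * a = of_int E * y"
      using ab by simp
    then show "Im (\<beta> * \<tau>) = Im (of_int E * \<sigma>)"
      by (simp add: \<sigma> \<beta>_Re \<beta>_Im flip: a_def b_def)
  qed
  moreover have "\<sigma> \<noteq> 0"
    using \<sigma>(1) by auto
  then have "\<beta> \<noteq> 0"
    using calculation pos by auto
  ultimately show thesis
    using that[of A E \<beta> B] A E pos \<beta>_def \<sigma>_def by blast
qed

text \<open>Substituting \<open>N - a = 2 * b * y\<close> turns the left side into
  \<open>4 * d^4 * y * b * (N - 2 * a + 1)\<close>. Multiplied by \<open>b\<close> it is at most
  \<open>8 * y * d^4 * N^2\<close>, by \<open>N - 2 * a + 1 \<le> 2 * N\<close> and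
  \<open>b^2 \<le> N\<close>; and 8 is below \<open>12 * sqrt 3\<close>.\<close>

lemma degree_bound:
  fixes a b d y :: real
  assumes "0 < b" "0 \<le> a" "a \<le> 1/2" "1 \<le> a\<^sup>2 + b\<^sup>2" and y: "2 * b * y = a\<^sup>2 + b\<^sup>2 - a"
  shows "d\<^sup>2 * (a\<^sup>2 + b\<^sup>2 - 2 * a + 1) * (2 * d\<^sup>2 * (a\<^sup>2 + b\<^sup>2 - a))
    \<le> 12 * sqrt 3 * y * d ^ 4 * (a\<^sup>2 + b\<^sup>2)\<^sup>2 / b"
proof -
  define N where "N = a\<^sup>2 + b\<^sup>2"
  have N: "1 \<le> N" "b\<^sup>2 \<le> N"
    using assms by (simp_all add: N_def)
  have "0 \<le> 2 * b * y"
    using assms by simp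
  then have y_nonneg: "0 \<le> y"
    using assms(1) by (simp add: zero_le_mult_iff)
  have "(N - 2 * a + 1) * b\<^sup>2 \<le> (2 * N) * N"
    using N assms by (intro mult_mono) auto
  also have "\<dots> \<le> 3 * sqrt 3 * N\<^sup>2"
  proof -
    have "1 \<le> sqrt 3"
      by simp
    then have "2 \<le> 3 * sqrt 3"
      by linarith
    then have "2 * N\<^sup>2 \<le> 3 * sqrt 3 * N\<^sup>2"
      by (intro mult_right_mono) auto
    then show ?thesis
      by (simp add: power2_eq_square)
  qed
  finally have "4 * d ^ 4 * y * ((N - 2 * a + 1) * b\<^sup>2) \<le> 4 * d ^ 4 * y * (3 * sqrt 3 * N\<^sup>2)"
    using y_nonneg by (intro mult_left_mono) auto
  then have "4 * d ^ 4 * y * (N - 2 * a + 1) * b * b \<le> 12 * sqrt 3 * y * d ^ 4 * N\<^sup>2"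
    by (simp add: power2_eq_square mult_ac)
  then have "4 * d ^ 4 * y * (N - 2 * a + 1) * b \<le> 12 * sqrt 3 * y * d ^ 4 * N\<^sup>2 / b"
    using assms(1) by (simp only: pos_le_divide_eq)
  moreover have "d\<^sup>2 * (N - 2 * a + 1) * (2 * d\<^sup>2 * (N - a)) = 4 * d ^ 4 * y * (N - 2 * a + 1) * b"
    using y[folded N_def] by algebra
  ultimately show ?thesis
    unfolding N_def by linarith
qed

lemma isogeny_circumcentre:
  fixes \<tau> :: complex
  defines "a \<equiv> Re \<tau>" and "b \<equiv> Im \<tau>" and "d \<equiv> real (denom \<tau>)"
  assumes fd: "\<tau> \<in> fund_domain" and rat: "rational_coords \<tau>"
  shows "\<exists>\<beta> \<delta>. isogeny \<beta> (Lat \<tau>) (Lat (circumcentre \<tau>)) \<and>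
      \<delta> = isogeny_degree \<beta> (Lat \<tau>) (Lat (circumcentre \<tau>)) \<and> 0 < \<delta> \<and>
      real \<delta> \<le> 12 * sqrt 3 * Im (circumcentre \<tau>) * d ^ 4 * (a\<^sup>2 + b\<^sup>2)\<^sup>2 / b"
    and "isogenous (Lat (circumcentre \<tau>)) (Lat \<tau>)"
proof -
  obtain \<beta> and A B E :: int where A: "of_int A = d\<^sup>2 * (a\<^sup>2 + b\<^sup>2 - 2 * a + 1)"
    and E: "of_int E = 2 * d\<^sup>2 * (a\<^sup>2 + b\<^sup>2 - a)" and pos: "0 < A" "0 < E" "\<beta> \<noteq> 0"
    and \<beta>: "\<beta> = of_int A - of_int B * circumcentre \<tau>" "\<beta> * \<tau> = of_int E * circumcentre \<tau>"
    using circumcentre_multiplier[OF fd rat] unfolding a_def b_def d_def by metis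
  have y: "2 * b * Im (circumcentre \<tau>) = a\<^sup>2 + b\<^sup>2 - a"
    using fund_domainD(3)[OF fd] by (simp add: circumcentre_def a_def b_def)
  have Im: "Im (circumcentre \<tau>) \<noteq> 0"
    using Im_circumcentre_pos[OF fd] by simp
  have "\<beta> = of_int A + of_int (- B) * circumcentre \<tau>"
    "\<beta> * \<tau> = of_int 0 + of_int E * circumcentre \<tau>"
    using \<beta> by simp_all
  then have isog: "isogeny \<beta> (Lat \<tau>) (Lat (circumcentre \<tau>))"
    using pos(3) by (intro isogeny_LatI) (unfold Lat_iff, blast+)
  have deg: "isogeny_degree \<beta> (Lat \<tau>) (Lat (circumcentre \<tau>)) = nat (A * E)"
    by (rule isogeny_degree_triangular[OF Im pos(1,2) \<beta>])
  have "real (nat (A * E)) = of_int A * of_int E"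
    using pos by simp
  also have "\<dots> \<le> 12 * sqrt 3 * Im (circumcentre \<tau>) * d ^ 4 * (a\<^sup>2 + b\<^sup>2)\<^sup>2 / b"
    unfolding A E
    by (rule degree_bound[OF fund_domainD(3,1,2,4)[OF fd, folded a_def b_def] y])
  finally show "\<exists>\<beta> \<delta>. isogeny \<beta> (Lat \<tau>) (Lat (circumcentre \<tau>)) \<and>
      \<delta> = isogeny_degree \<beta> (Lat \<tau>) (Lat (circumcentre \<tau>)) \<and> 0 < \<delta> \<and>
      real \<delta> \<le> 12 * sqrt 3 * Im (circumcentre \<tau>) * d ^ 4 * (a\<^sup>2 + b\<^sup>2)\<^sup>2 / b"
    using isog deg pos by (intro exI[of _ \<beta>] exI[of _ "nat (A * E)"]) simp
  show "isogenous (Lat (circumcentre \<tau>)) (Lat \<tau>)"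
    using isogenous_sym_triangular[OF pos(3) _ _ \<beta>] pos by simp
qed

section \<open>The deep hole sequence\<close>

text \<open>Real part 1/2 and a positive imaginary part are automatic, so the modulus is the only
  condition that can fail.\<close>

lemma circumcentre_in_fund_domain:
  assumes "\<tau> \<in> fund_domain" "\<not> cmod (circumcentre \<tau>) \<le> 1"
  shows "circumcentre \<tau> \<in> fund_domain"
  using assms Im_circumcentre_pos[OF assms(1)]
  by (simp add: fund_domain_def) (simp add: circumcentre_def)

lemma tau_seq_in_fund_domain:
  assumes "\<tau> \<in> fund_domain" "\<And>m. 0 < m \<Longrightarrow> m \<le> k \<Longrightarrow> \<not> cmod (tau_seq \<tau> m) \<le> 1"
  shows "tau_seq \<tau> k \<in> fund_domain"
  using assms(2)
proof (induction k)
  case (Suc k)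
  then have "tau_seq \<tau> k \<in> fund_domain"
    by simp
  then show ?case
    using Suc.prems[of "Suc k"] circumcentre_in_fund_domain by (simp add: tau_seq_Suc)
qed (simp add: assms(1))

lemma Im_circumcentre_le_half:
  assumes "\<tau> \<in> fund_domain"
  shows "Im (circumcentre \<tau>) \<le> Im \<tau> / 2"
proof -
  note \<tau> = fund_domainD[OF assms]
  have "Re \<tau> * Re \<tau> \<le> 1 * Re \<tau>"
    using \<tau> by (intro mult_right_mono) auto
  then have "(Re \<tau>)\<^sup>2 + (Im \<tau>)\<^sup>2 - Re \<tau> \<le> Im \<tau> * Im \<tau>"
    by (simp add: power2_eq_square)
  then show ?thesis
    using \<tau> by (simp add: circumcentre_def field_simps)
qed

text \<open>Otherwise every term stays in \<open>fund_domain\<close> while the halving imaginary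
  parts drop below 1/2; with real part at most 1/2 the modulus would then be below 1.\<close>

lemma tau_seq_reaches_unit_disc:
  assumes "\<tau> \<in> fund_domain"
  shows "\<exists>n>0. cmod (tau_seq \<tau> n) \<le> 1"
proof (rule ccontr)
  assume none: "\<not> ?thesis"
  then have fd: "tau_seq \<tau> k \<in> fund_domain" for k
    using tau_seq_in_fund_domain[OF assms] by blast
  have bound: "Im (tau_seq \<tau> k) \<le> Im \<tau> * (1/2) ^ k" for k
  proof (induction k)
    case (Suc k)
    then show ?case
      using Im_circumcentre_le_half[OF fd[of k]] by (simp add: tau_seq_Suc)
  qed simp
  have "(\<lambda>k. Im \<tau> * (1/2) ^ k) \<longlonglongrightarrow> Im \<tau> * 0"
    by (intro tendsto_intros) simp
  then have "\<forall>\<^sub>F k in sequentially. Im \<tau> * (1/2) ^ k < 1/2"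
    by (rule order_tendstoD(2)) simp
  then obtain k where "Im \<tau> * (1/2) ^ k < 1/2"
    by (auto simp: eventually_sequentially)
  then have k: "Im (tau_seq \<tau> k) < 1/2"
    using bound[of k] by linarith
  note f = fund_domainD[OF fd[of k]]
  have "(Re (tau_seq \<tau> k))\<^sup>2 \<le> (1/2)\<^sup>2" "(Im (tau_seq \<tau> k))\<^sup>2 \<le> (1/2)\<^sup>2"
    using f k by (intro power_mono; simp)+
  then show False
    using f(4) by (simp add: power2_eq_square)
qed

lemma rational_coords_tau_seq:
  assumes "rational_coords \<tau>"
  shows "rational_coords (tau_seq \<tau> k)"
  by (induction k) (simp_all add: assms tau_seq_Suc rational_coords_circumcentre)

theorem theorem1p3:
  fixes \<tau>0 :: complex and a b :: "nat \<Rightarrow> real" and d :: "nat \<Rightarrow> nat"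
  defines "a \<equiv> \<lambda>k. Re (tau_seq \<tau>0 k)"
    and "b \<equiv> \<lambda>k. Im (tau_seq \<tau>0 k)"
    and "d \<equiv> \<lambda>k. denom (tau_seq \<tau>0 k)"
  assumes "\<tau>0 \<in> fund_domain"
    and "quadratic_irrationality \<tau>0"
  shows "\<exists>n::nat. 0 < n \<and> cmod (tau_seq \<tau>0 n) \<le> 1 \<and>
      (\<forall>m. 0 < m \<and> m < n \<longrightarrow> \<not> cmod (tau_seq \<tau>0 m) \<le> 1) \<and>
      (\<forall>k<n. deep_hole_lattice (Lat (tau_seq \<tau>0 k)) (Lat (tau_seq \<tau>0 (Suc k)))) \<and>
      (\<forall>j\<le>n. \<forall>k\<le>n. isogenous (Lat (tau_seq \<tau>0 j)) (Lat (tau_seq \<tau>0 k))) \<and>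
      (\<forall>k<n. \<exists>\<beta> \<delta>. isogeny \<beta> (Lat (tau_seq \<tau>0 k)) (Lat (tau_seq \<tau>0 (Suc k))) \<and>
         \<delta> = isogeny_degree \<beta> (Lat (tau_seq \<tau>0 k)) (Lat (tau_seq \<tau>0 (Suc k))) \<and> 0 < \<delta> \<and>
         real \<delta> \<le> 12 * sqrt 3 * b (Suc k) * real (d k) ^ 4 * ((a k)\<^sup>2 + (b k)\<^sup>2)\<^sup>2 / b k)"
proof -
  define P where "P = (\<lambda>n. 0 < n \<and> cmod (tau_seq \<tau>0 n) \<le> 1)"
  define n where "n = (LEAST n. P n)"
  have "\<exists>n. P n"
    using tau_seq_reaches_unit_disc[OF assms(4)] by (auto simp: P_def)
  then have n: "P n"
    unfolding n_def by (rule LeastI_ex)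
  have least: "\<not> cmod (tau_seq \<tau>0 m) \<le> 1" if "0 < m" "m < n" for m
    using not_less_Least[of m P] that by (auto simp: n_def P_def)
  \<comment> \<open>The index \<open>n\<close> itself is excluded, since the last term may lie
    outside the domain; each step and each isogeny only starts from a term with
    \<open>k < n\<close>.\<close>
  have fd: "tau_seq \<tau>0 k \<in> fund_domain" if "k < n" for k
    using that by (intro tau_seq_in_fund_domain[OF assms(4)] least) auto
  have rat: "rational_coords (tau_seq \<tau>0 k)" for k
    using rational_coords_quadratic[OF assms(5)] fund_domainD(3)[OF assms(4)]
    by (intro rational_coords_tau_seq) simp
  have isog: "\<exists>\<beta> \<delta>. isogeny \<beta> (Lat (tau_seq \<tau>0 k)) (Lat (tau_seq \<tau>0 (Suc k))) \<and>
         \<delta> = isogeny_degree \<beta> (Lat (tau_seq \<tau>0 k)) (Lat (tau_seq \<tau>0 (Suc k))) \<and> 0 < \<delta> \<and>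
         real \<delta> \<le> 12 * sqrt 3 * b (Suc k) * real (d k) ^ 4 * ((a k)\<^sup>2 + (b k)\<^sup>2)\<^sup>2 / b k"
    if "k < n" for k
    using isogeny_circumcentre(1)[OF fd[OF that] rat]
    unfolding a_def b_def d_def tau_seq_Suc .
  \<comment> \<open>Both directions are carried through the induction, so that any two terms can be
    joined through the initial one.\<close>
  have base: "isogenous (Lat \<tau>0) (Lat (tau_seq \<tau>0 k)) \<and> isogenous (Lat (tau_seq \<tau>0 k)) (Lat \<tau>0)"
    if "k \<le> n" for k
    using that
  proof (induction k)
    case (Suc k)
    then have "isogenous (Lat (tau_seq \<tau>0 k)) (Lat (tau_seq \<tau>0 (Suc k)))"
      "isogenous (Lat (tau_seq \<tau>0 (Suc k))) (Lat (tau_seq \<tau>0 k))"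
      using isog[of k] isogeny_circumcentre(2)[OF fd rat, of k]
      by (auto simp: isogenous_def tau_seq_Suc)
    with Suc show ?case
      by (meson isogenous_trans Suc_leD)
  qed (simp add: isogenous_refl)
  show ?thesis
  proof (intro exI[of _ n] conjI allI impI)
    show "0 < n" "cmod (tau_seq \<tau>0 n) \<le> 1"
      using n by (simp_all add: P_def)
    show "deep_hole_lattice (Lat (tau_seq \<tau>0 k)) (Lat (tau_seq \<tau>0 (Suc k)))" if "k < n" for k
      using deep_hole_lattice_circumcentre[OF fd[OF that]] by (simp add: tau_seq_Suc)
    show "isogenous (Lat (tau_seq \<tau>0 j)) (Lat (tau_seq \<tau>0 k))" if "j \<le> n" "k \<le> n" for j k
      using base that isogenous_trans by blast
  qed (use least isog in auto)
qed

end
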